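(* Let $K$ be a field of characteristic $0$, let $n\geq 1$, and let $F=(F_1,\dots,F_n):K^n\to K^n$ be a polynomial map of the form $F_i(X_1,\dots,X_n)=X_i+H_i(X_1,\dots,X_n)$, $1\leq i\leq n$, where each $H_i\in K[X_1,\dots,X_n]$ is a polynomial of lower degree $\geq 2$ (that is, every monomial occurring in $H_i$ with nonzero coefficient has total degree at least $2$). Let $T\in \operatorname{GL}(n,K)$ and let $\widetilde{F}:=T^{-1}\circ F\circ T$. If $F$ is nice, then $\widetilde{F}$ is nice.
   Context: $K$ is a field of characteristic $0$. A polynomial map $F=(F_1,\dots,F_n):K^n\to K^n$ is a map whose components $F_i$ are in the polynomial ring $K[X_1,\dots,X_n]$. Given such $F$, define for $i=1,\dots,n$ the polynomials $P_0^i=X_i$ and, for $k\geq 1$, $P_k^i(X_1,\dots,X_n)=P_{k-1}^i(F_1,\dots,F_n)-P_{k-1}^i(X_1,\dots,X_n)$ (so $P_1^i=F_i-X_i$). The map $F$ is called nice if there exists an integer $m$ such that $P_m^i=0$ for all $i=1,\dots,n$. The matrix $T\in\operatorname{GL}(n,K)$ is identified with the linear map $K^n\to K^n$ it defines. *)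

theory Defs
  imports "HOL-Analysis.Analysis" "HOL-Library.Poly_Mapping"
begin

text \<open>
  Formal polynomials over a coefficient type \<open>'k\<close> in the variables \<open>X i\<close> with \<open>i :: 'n\<close>: finitely
  supported maps from exponent vectors to coefficients. The ring structure is that of
  \<^theory>\<open>HOL-Library.Poly_Mapping\<close>.
\<close>

type_synonym ('k, 'n) mpoly = "('n \<Rightarrow>\<^sub>0 nat) \<Rightarrow>\<^sub>0 'k"

definition Const :: "'k::comm_ring_1 \<Rightarrow> ('k, 'n) mpoly"
  where "Const c = Poly_Mapping.single 0 c"

definition Var :: "'n \<Rightarrow> ('k::comm_ring_1, 'n) mpoly"
  where "Var i = Poly_Mapping.single (Poly_Mapping.single i 1) 1"

definition total_deg :: "('n::finite \<Rightarrow>\<^sub>0 nat) \<Rightarrow> nat"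
  where "total_deg m = (\<Sum>i\<in>UNIV. Poly_Mapping.lookup m i)"

definition peval :: "('k::comm_ring_1, 'n::finite) mpoly \<Rightarrow> 'k ^ 'n \<Rightarrow> 'k"
  where "peval p x =
    (\<Sum>m\<in>Poly_Mapping.keys p. Poly_Mapping.lookup p m * (\<Prod>i\<in>UNIV. (x $ i) ^ Poly_Mapping.lookup m i))"

text \<open>\<open>subst p F\<close> is \<open>p(F\<^sub>1, \<dots>, F\<^sub>n)\<close>.\<close>

definition subst :: "('k::comm_ring_1, 'n::finite) mpoly \<Rightarrow> ('k, 'n) mpoly ^ 'n \<Rightarrow> ('k, 'n) mpoly"
  where "subst p F =
    (\<Sum>m\<in>Poly_Mapping.keys p.
      Const (Poly_Mapping.lookup p m) * (\<Prod>i\<in>UNIV. (F $ i) ^ Poly_Mapping.lookup m i))"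

text \<open>A polynomial map \<open>K\<^sup>n \<rightarrow> K\<^sup>n\<close> is given by the tuple of its component polynomials.\<close>

type_synonym ('k, 'n) polymap = "('k, 'n) mpoly ^ 'n"

definition pmap_eval :: "('k::comm_ring_1, 'n::finite) polymap \<Rightarrow> 'k ^ 'n \<Rightarrow> 'k ^ 'n"
  where "pmap_eval F x = (\<chi> i. peval (F $ i) x)"

definition pmap_comp ::
    "('k::comm_ring_1, 'n::finite) polymap \<Rightarrow> ('k, 'n) polymap \<Rightarrow> ('k, 'n) polymap"
    (infixl "\<circ>\<^sub>p" 55)
  where "F \<circ>\<^sub>p G = (\<chi> i. subst (F $ i) G)"

definition pmap_of_matrix :: "'k::comm_ring_1 ^ 'n ^ 'n::finite \<Rightarrow> ('k, 'n) polymap"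
  where "pmap_of_matrix T = (\<chi> i. \<Sum>j\<in>UNIV. Const (T $ i $ j) * Var j)"

primrec P_seq :: "('k::comm_ring_1, 'n::finite) polymap \<Rightarrow> nat \<Rightarrow> 'n \<Rightarrow> ('k, 'n) mpoly"
  where
    "P_seq F 0 i = Var i"
  | "P_seq F (Suc k) i = subst (P_seq F k i) F - P_seq F k i"

definition nice :: "('k::comm_ring_1, 'n::finite) polymap \<Rightarrow> bool"
  where "nice F \<longleftrightarrow> (\<exists>m. \<forall>i. P_seq F m i = 0)"

text \<open>Composition of tuples and the tuple of a matrix induce the expected maps on \<open>K\<^sup>n\<close>.\<close>

lemma peval_superset:
  assumes "finite S" "Poly_Mapping.keys p \<subseteq> S"
  shows "peval p x =
    (\<Sum>m\<in>S. Poly_Mapping.lookup p m * (\<Prod>i\<in>UNIV. (x $ i) ^ Poly_Mapping.lookup m i))"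
  unfolding peval_def using assms
  by (intro sum.mono_neutral_left) (auto simp: in_keys_iff)

lemma peval_zero [simp]: "peval 0 x = 0"
  by (simp add: peval_def)

lemma peval_single [simp]:
  "peval (Poly_Mapping.single m c) x = c * (\<Prod>i\<in>UNIV. (x $ i) ^ Poly_Mapping.lookup m i)"
  by (subst peval_superset[of "{m}"]) (auto simp: lookup_single)

lemma peval_add [simp]: "peval (p + q) x = peval p x + peval q x"
proof -
  let ?S = "Poly_Mapping.keys p \<union> Poly_Mapping.keys q"
  have "Poly_Mapping.keys (p + q) \<subseteq> ?S" by (rule Poly_Mapping.keys_add)
  then show ?thesis
    by (simp add: peval_superset[of ?S] lookup_add distrib_right sum.distrib)
qed

lemma peval_sum: "peval (sum f A) x = (\<Sum>a\<in>A. peval (f a) x)"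
  by (induction A rule: infinite_finite_induct) auto

lemma mpoly_sum_single:
  "p = (\<Sum>m\<in>Poly_Mapping.keys p. Poly_Mapping.single m (Poly_Mapping.lookup p m))"
  by (rule poly_mapping_eqI) (auto simp: lookup_sum lookup_single when_def in_keys_iff sum.delta)

lemma peval_mult [simp]: "peval (p * q) x = peval p x * peval q x"
proof -
  have "peval (p * q) x =
    (\<Sum>m\<in>Poly_Mapping.keys p. \<Sum>m'\<in>Poly_Mapping.keys q.
      peval (Poly_Mapping.single m (Poly_Mapping.lookup p m)) x *
      peval (Poly_Mapping.single m' (Poly_Mapping.lookup q m')) x)"
    by (subst mpoly_sum_single[of p], subst mpoly_sum_single[of q])
       (simp add: sum_product peval_sum mult_single lookup_add power_add prod.distrib mult_ac)
  also have "\<dots> = peval p x * peval q x"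
    by (simp add: peval_def[of p] peval_def[of q] sum_product)
  finally show ?thesis .
qed

lemma peval_Const [simp]: "peval (Const c) x = c"
  by (simp add: Const_def)

lemma peval_one [simp]: "peval 1 x = 1"
  using peval_Const[of 1 x] by (simp add: Const_def)

lemma peval_Var [simp]: "peval (Var i) x = x $ i"
proof -
  have "(\<Prod>j\<in>UNIV. (x $ j) ^ (1 when i = j)) = (\<Prod>j\<in>UNIV. if i = j then x $ j else 1)"
    by (rule prod.cong) (auto simp: when_def)
  then show ?thesis
    by (simp add: Var_def lookup_single)
qed

lemma peval_power [simp]: "peval (p ^ k) x = peval p x ^ k"
  by (induction k) auto

lemma peval_prod: "peval (prod f A) x = (\<Prod>a\<in>A. peval (f a) x)"
  by (induction A rule: infinite_finite_induct) auto

lemma pmap_eval_comp: "pmap_eval (F \<circ>\<^sub>p G) = pmap_eval F \<circ> pmap_eval G"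
  by (auto simp: fun_eq_iff pmap_eval_def pmap_comp_def subst_def peval_sum peval_prod vec_eq_iff
      peval_def[of "F $ _"])

lemma pmap_eval_of_matrix: "pmap_eval (pmap_of_matrix T) x = T *v x"
  by (simp add: pmap_eval_def pmap_of_matrix_def peval_sum matrix_vector_mult_def)

end

(* Substitution by F is a ring endomorphism s_F of the polynomial ring, and P_k^i = (s_F - id)^k X_i.
   Conjugating F by T conjugates s_F, so P_k^i of the conjugate map is the T^-1-linear combination
   of the polynomials P_k^j o T; this vanishes for every i as soon as all P_k^j vanish. *)

theory Submission
  imports Defs
begin

text \<open>Exponents outside the support carry coefficient 0 and add nothing. A common index set
  for several polynomials makes additivity of \<open>subst\<close> a termwise computation.\<close>

lemma subst_superset:
  assumes "finite S" "Poly_Mapping.keys p \<subseteq> S"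
  shows "subst p F =
    (\<Sum>m\<in>S. Const (Poly_Mapping.lookup p m) * (\<Prod>i\<in>UNIV. (F $ i) ^ Poly_Mapping.lookup m i))"
  unfolding subst_def using assms
  by (intro sum.mono_neutral_left) (auto simp: in_keys_iff Const_def)

lemma Const_zero [simp]: "Const 0 = 0"
  by (simp add: Const_def)

lemma Const_one [simp]: "Const 1 = 1"
  by (simp add: Const_def)

lemma Const_add: "Const (a + b) = Const a + Const b"
  by (simp add: Const_def single_add)

lemma Const_mult: "Const (a * b) = Const a * Const b"
  by (simp add: Const_def mult_single)

lemma Const_sum: "Const (sum f A) = (\<Sum>a\<in>A. Const (f a))"
  by (induction A rule: infinite_finite_induct) (auto simp: Const_add)

lemma subst_zero [simp]: "subst 0 F = 0"
  by (simp add: subst_def)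

lemma subst_single:
  "subst (Poly_Mapping.single m c) F = Const c * (\<Prod>i\<in>UNIV. (F $ i) ^ Poly_Mapping.lookup m i)"
  by (subst subst_superset[of "{m}"]) (auto simp: lookup_single)

lemma subst_add [simp]: "subst (p + q) F = subst p F + subst q F"
proof -
  let ?S = "Poly_Mapping.keys p \<union> Poly_Mapping.keys q"
  have "Poly_Mapping.keys (p + q) \<subseteq> ?S" by (rule Poly_Mapping.keys_add)
  then show ?thesis
    by (simp add: subst_superset[of ?S] lookup_add Const_add distrib_right sum.distrib)
qed

lemma subst_diff [simp]: "subst (p - q) F = subst p F - subst q F"
  using subst_add[of "p - q" q F] by simp

lemma subst_sum: "subst (sum f A) F = (\<Sum>a\<in>A. subst (f a) F)"
  by (induction A rule: infinite_finite_induct) auto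

text \<open>By additivity both factors split into monomials. On monomials exponents add and
  coefficients multiply, and \<open>subst\<close> turns this into a product of powers.\<close>

lemma subst_mult [simp]: "subst (p * q) F = subst p F * subst q F"
proof -
  have "subst (p * q) F =
    (\<Sum>m\<in>Poly_Mapping.keys p. \<Sum>m'\<in>Poly_Mapping.keys q.
      subst (Poly_Mapping.single m (Poly_Mapping.lookup p m)) F *
      subst (Poly_Mapping.single m' (Poly_Mapping.lookup q m')) F)"
    by (subst mpoly_sum_single[of p], subst mpoly_sum_single[of q])
       (simp add: sum_product subst_sum subst_single mult_single lookup_add power_add
         prod.distrib Const_mult mult_ac)
  also have "\<dots> = subst p F * subst q F"
    by (simp add: subst_def[of p] subst_def[of q] sum_product subst_single)
  finally show ?thesis .
qed

lemma subst_Const [simp]: "subst (Const c) F = Const c"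
proof -
  have "subst (Const c) F = Const c * (\<Prod>i\<in>UNIV. (F $ i) ^ 0)"
    unfolding Const_def[of c] subst_single by (simp add: Const_def)
  then show ?thesis by simp
qed

lemma subst_one [simp]: "subst 1 F = 1"
  using subst_Const[of 1 F] by simp

lemma subst_Var [simp]: "subst (Var i) F = F $ i"
proof -
  have "(\<Prod>j\<in>UNIV. (F $ j) ^ (1 when i = j)) = (\<Prod>j\<in>UNIV. if i = j then F $ j else 1)"
    by (rule prod.cong) (auto simp: when_def)
  then show ?thesis
    by (simp add: Var_def subst_single lookup_single)
qed

lemma subst_power [simp]: "subst (p ^ k) F = subst p F ^ k"
  by (induction k) auto

lemma subst_prod: "subst (prod f A) F = (\<Prod>a\<in>A. subst (f a) F)"
  by (induction A rule: infinite_finite_induct) auto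

text \<open>Substituting \<open>G\<close> is a ring homomorphism fixing constants, so it passes
  through the monomial expansion of \<open>subst p F\<close> and acts only on the components of
  \<open>F\<close>.\<close>

lemma subst_subst: "subst (subst p F) G = subst p (F \<circ>\<^sub>p G)"
  by (simp add: subst_def[of p] subst_sum subst_prod pmap_comp_def)

lemma pmap_comp_assoc:
  fixes F G H :: "('k::comm_ring_1, 'n::finite) polymap"
  shows "(F \<circ>\<^sub>p G) \<circ>\<^sub>p H = F \<circ>\<^sub>p (G \<circ>\<^sub>p H)"
  by (simp add: pmap_comp_def[of _ H] pmap_comp_def[of F] subst_subst vec_eq_iff)

lemma pmap_of_matrix_comp_nth:
  "(pmap_of_matrix A \<circ>\<^sub>p F) $ i = (\<Sum>j\<in>UNIV. Const (A $ i $ j) * F $ j)"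
  by (simp add: pmap_comp_def pmap_of_matrix_def subst_sum)

lemma pmap_of_matrix_mult:
  "pmap_of_matrix A \<circ>\<^sub>p pmap_of_matrix B = pmap_of_matrix (A ** B)"
proof -
  \<comment> \<open>An entry of \<open>A ** B\<close> is the coefficient of one
    \<open>Var l\<close>, so the sum over the middle index \<open>j\<close> has to become the inner
    one.\<close>
  have "(\<Sum>j\<in>UNIV. \<Sum>l\<in>UNIV. Const (A $ i $ j) * (Const (B $ j $ l) * Var l)) =
      (\<Sum>l\<in>UNIV. \<Sum>j\<in>UNIV. Const (A $ i $ j) * (Const (B $ j $ l) * Var l))" for i
    by (rule sum.swap)
  then show ?thesis
    by (simp add: vec_eq_iff pmap_of_matrix_comp_nth)
       (simp add: pmap_of_matrix_def matrix_matrix_mult_def Const_sum Const_mult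
         sum_distrib_left sum_distrib_right mult.assoc)
qed

lemma pmap_of_matrix_one:
  "pmap_of_matrix (mat 1) = ((\<chi> i. Var i) :: ('k::comm_ring_1, 'n::finite) polymap)"
proof -
  have "(\<Sum>j\<in>UNIV. Const (if i = j then 1 else 0) * Var j) =
      (\<Sum>j\<in>UNIV. if i = j then Var j else (0 :: ('k, 'n) mpoly))" for i
    by (rule sum.cong) auto
  then show ?thesis
    by (simp add: vec_eq_iff pmap_of_matrix_def mat_def)
qed

lemma Var_pmap_comp [simp]: "(\<chi> i. Var i) \<circ>\<^sub>p F = F"
  by (simp add: pmap_comp_def vec_eq_iff)

text \<open>Constants are fixed by substitution, so the combination with row \<open>i\<close> of
  \<open>A\<close> commutes with taking differences, and induction on \<open>k\<close>
  applies.\<close>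

lemma P_seq_conjugate:
  assumes "A ** T = mat 1" "T ** A = mat 1"
  shows "P_seq (pmap_of_matrix A \<circ>\<^sub>p F \<circ>\<^sub>p pmap_of_matrix T) k i =
    (\<Sum>j\<in>UNIV. Const (A $ i $ j) * subst (P_seq F k j) (pmap_of_matrix T))"
proof (induction k arbitrary: i)
  case 0
  \<comment> \<open>For \<open>k = 0\<close> the claim is row \<open>i\<close> of
    \<open>A ** T = mat 1\<close>.\<close>
  have "Var i = (pmap_of_matrix A \<circ>\<^sub>p pmap_of_matrix T) $ i"
    by (simp add: pmap_of_matrix_mult assms pmap_of_matrix_one)
  then show ?case by (simp add: pmap_of_matrix_comp_nth)
next
  case (Suc k)
  let ?T = "pmap_of_matrix T"
  let ?G = "pmap_of_matrix A \<circ>\<^sub>p F \<circ>\<^sub>p ?T"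
  \<comment> \<open>The other identity, \<open>T ** A = mat 1\<close>, cancels the left factor of
    \<open>?G\<close>. The resulting intertwining turns substituting \<open>?T\<close> and then
    \<open>?G\<close> into substituting \<open>F\<close> and then \<open>?T\<close>, which is the
    step from \<open>k\<close> to \<open>Suc k\<close>.\<close>
  have "?T \<circ>\<^sub>p ?G = (?T \<circ>\<^sub>p pmap_of_matrix A) \<circ>\<^sub>p F \<circ>\<^sub>p ?T"
    by (simp add: pmap_comp_assoc)
  then have "?T \<circ>\<^sub>p ?G = F \<circ>\<^sub>p ?T"
    by (simp add: pmap_of_matrix_mult assms pmap_of_matrix_one)
  then show ?case
    by (simp add: Suc.IH subst_sum subst_subst sum_subtractf right_diff_distrib)
qed

theorem theorem3:
  fixes F H :: "('k::field_char_0, 'n::finite) polymap"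
    and T :: "'k ^ 'n ^ 'n"
  assumes "\<And>i. F $ i = Var i + H $ i"
    and "\<And>i m. m \<in> Poly_Mapping.keys (H $ i) \<Longrightarrow> total_deg m \<ge> 2"
    and "invertible T"
    and "nice F"
  shows "nice (pmap_of_matrix (matrix_inv T) \<circ>\<^sub>p F \<circ>\<^sub>p pmap_of_matrix T)"
proof -
  from \<open>nice F\<close> obtain m where "\<And>i. P_seq F m i = 0"
    by (auto simp: nice_def)
  \<comment> \<open>\<open>matrix_inv\<close> is a choice of two-sided inverse; invertibility of
    \<open>T\<close> guarantees that one exists.\<close>
  moreover have "T ** matrix_inv T = mat 1" "matrix_inv T ** T = mat 1"
    using someI_ex[OF \<open>invertible T\<close>[unfolded invertible_def]] by (auto simp: matrix_inv_def)
  ultimately show ?thesis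
    \<comment> \<open>The same index \<open>m\<close> serves the conjugate, since every summand in
      its formula contains some \<open>P_seq F m j = 0\<close>.\<close>
    unfolding nice_def by (intro exI[of _ m]) (simp add: P_seq_conjugate)
qed

end
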